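(* Let $p>3$ be a prime. In the polynomial ring $\mathbb{Z}_p[\beta]$, set $x=\beta(1-\beta)$ and $\alpha=1-\beta$. Then \[ \sum_{k=1}^{p-1}\binom{2k}{k}\frac{x^k}{k}\equiv\pounds_1(\alpha)+\pounds_1(\beta)\pmod{p}, \] \[ \sum_{k=1}^{p-1}\binom{2k}{k}\frac{x^k}{k^2}\equiv 2\pounds_2(\alpha)+2\pounds_2(\beta)\pmod{p}, \] \[ \sum_{k=1}^{p-1}\binom{2k}{k}\left(\frac{H_k^{(2)}}{k}+\frac{1}{k^3}\right)x^k\equiv 4\pounds_3(\alpha)+4\pounds_3(\beta)\pmod{p}. \]
   Context: $\mathbb{Z}_p$ denotes the ring of $p$-adic integers. For the fixed prime $p$ and an integer $d$, the finite polylogarithm is the polynomial $\pounds_d(t)=\sum_{k=1}^{p-1}t^k/k^d$. $H_k^{(2)}=\sum_{j=1}^{k}1/j^2$. Congruence modulo $p$ means the difference lies in $p\,\mathbb{Z}_p[\beta]$. *)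

theory Defs
  imports
    "HOL-Computational_Algebra.Polynomial"
    "Berlekamp_Zassenhaus.Finite_Field"
begin

text \<open>
  The prime \<open>p\<close> is carried by a type argument: for \<open>'p :: prime_card\<close>, the number \<open>p = CARD('p)\<close>
  is prime, and a free type variable of this class ranges over all primes.

  The ring of \<open>p\<close>-adic integers is the inverse limit of the rings of integers modulo \<open>p ^ n\<close>.
  An element is its coherent sequence of residues, entry \<open>n\<close> being the representative of the
  residue modulo \<open>p ^ n\<close> that lies in \<open>{0..<p ^ n}\<close> (so entry \<open>0\<close> is always \<open>0\<close>).
\<close>

typedef (overloaded) ('p :: prime_card) padic_int =
  "{a :: nat \<Rightarrow> int. \<forall>n. a n \<in> {0..<int CARD('p) ^ n} \<and> a (Suc n) mod int CARD('p) ^ n = a n}"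
  by (rule exI[of _ "\<lambda>_. 0"]) simp

setup_lifting type_definition_padic_int

lemma card_pos: "int CARD('p :: prime_card) > 0"
  using prime_card[where ?'a = 'p] by (simp add: prime_gt_0_nat)

lemma card_gt_1: "int CARD('p :: prime_card) > 1"
  using prime_card[where ?'a = 'p] prime_gt_1_nat by fastforce

lemma coherent_modI:
  fixes f :: "nat \<Rightarrow> int"
  assumes "\<And>n. [f (Suc n) = f n] (mod int CARD('p :: prime_card) ^ n)"
  shows "f n mod int CARD('p) ^ n \<in> {0..<int CARD('p) ^ n} \<and>
    f (Suc n) mod int CARD('p) ^ Suc n mod int CARD('p) ^ n = f n mod int CARD('p) ^ n"
proof -
  have "int CARD('p) ^ n dvd int CARD('p) ^ Suc n" by simp
  hence "f (Suc n) mod int CARD('p) ^ Suc n mod int CARD('p) ^ n = f (Suc n) mod int CARD('p) ^ n"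
    by (rule mod_mod_cancel)
  also have "\<dots> = f n mod int CARD('p) ^ n"
    using assms[of n] by (simp add: cong_def)
  finally show ?thesis
    using card_pos[where ?'p = 'p] by simp
qed

lemma coherent_cong:
  fixes a :: "nat \<Rightarrow> int"
  assumes "\<And>n. a n \<in> {0..<int CARD('p :: prime_card) ^ n} \<and> a (Suc n) mod int CARD('p) ^ n = a n"
  shows "[a (Suc n) = a n] (mod int CARD('p) ^ n)"
proof -
  have "a (Suc n) mod int CARD('p) ^ n = a n" using assms by blast
  thus ?thesis by (metis cong_def mod_mod_trivial)
qed

instantiation padic_int :: (prime_card) comm_ring_1
begin

lift_definition zero_padic_int :: "'a padic_int" is "\<lambda>n. 0 mod int CARD('a) ^ n"
  by (rule coherent_modI) simp

lift_definition one_padic_int :: "'a padic_int" is "\<lambda>n. 1 mod int CARD('a) ^ n"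
  by (rule coherent_modI) simp

lift_definition plus_padic_int :: "'a padic_int \<Rightarrow> 'a padic_int \<Rightarrow> 'a padic_int" is
  "\<lambda>a b n. (a n + b n) mod int CARD('a) ^ n"
  by (rule coherent_modI) (intro cong_add coherent_cong)

lift_definition times_padic_int :: "'a padic_int \<Rightarrow> 'a padic_int \<Rightarrow> 'a padic_int" is
  "\<lambda>a b n. (a n * b n) mod int CARD('a) ^ n"
  by (rule coherent_modI) (intro cong_mult coherent_cong)

lift_definition uminus_padic_int :: "'a padic_int \<Rightarrow> 'a padic_int" is
  "\<lambda>a n. (- a n) mod int CARD('a) ^ n"
  by (rule coherent_modI) (subst cong_minus_minus_iff, rule coherent_cong)

lift_definition minus_padic_int :: "'a padic_int \<Rightarrow> 'a padic_int \<Rightarrow> 'a padic_int" is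
  "\<lambda>a b n. (a n - b n) mod int CARD('a) ^ n"
  by (rule coherent_modI) (intro cong_diff coherent_cong)

instance
proof
  fix a b c :: "'a padic_int"
  show "a * b * c = a * (b * c)" "a * b = b * a" "a + b + c = a + (b + c)" "a + b = b + a"
    "- a + a = 0" "a - b = a + - b" "(a + b) * c = a * c + b * c"
    by (transfer; simp add: fun_eq_iff mod_simps algebra_simps)+
  show "1 * a = a" "0 + a = a"
    by (transfer; simp add: fun_eq_iff mod_simps)+
  show "(0 :: 'a padic_int) \<noteq> 1"
  proof (transfer, rule notI)
    assume "(\<lambda>n. 0 mod int CARD('a) ^ n) = (\<lambda>n. 1 mod int CARD('a) ^ n)"
    from fun_cong[OF this, of 1] show False using card_gt_1[where ?'p = 'a] by simp
  qed
qed

end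

text \<open>
  Division is only meaningful when the divisor is a unit; the inverse of a non-unit is set to \<open>0\<close>.
\<close>

instantiation padic_int :: (prime_card) inverse
begin

definition inverse_padic_int :: "'a padic_int \<Rightarrow> 'a padic_int" where
  "inverse_padic_int a = (if a dvd 1 then THE b. a * b = 1 else 0)"

definition divide_padic_int :: "'a padic_int \<Rightarrow> 'a padic_int \<Rightarrow> 'a padic_int" where
  "divide_padic_int a b = a * inverse b"

instance ..

end

lemma padic_unit_inverse:
  fixes a :: "('p :: prime_card) padic_int"
  assumes "a dvd 1"
  shows "a * inverse a = 1"
proof -
  obtain b where b: "a * b = 1" using assms by (metis dvdE)
  have "c = b" if "a * c = 1" for c
    using b that by (metis mult.assoc mult.commute mult.right_neutral)
  hence "(THE b. a * b = 1) = b" using b by blast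
  thus ?thesis using assms b by (simp add: inverse_padic_int_def)
qed

lemma Rep_padic_int_of_nat:
  "Rep_padic_int (of_nat k :: ('p :: prime_card) padic_int) n = int k mod int CARD('p) ^ n"
  by (induction k)
    (simp_all add: zero_padic_int.rep_eq plus_padic_int.rep_eq one_padic_int.rep_eq mod_simps)

text \<open>
  Hence the divisions by powers of \<open>1, \<dots>, p - 1\<close> below are genuine ones.
\<close>

lemma padic_of_nat_unit:
  assumes "\<not> CARD('p :: prime_card) dvd k"
  shows "(of_nat k :: 'p padic_int) dvd 1"
proof -
  let ?p = "int CARD('p)"
  have "coprime CARD('p) k"
    using assms prime_card[where ?'a = 'p] by (simp add: prime_imp_coprime)
  hence cop: "coprime (int k) (?p ^ n)" for n
    by (simp add: coprime_commute)
  have "\<exists>b. \<forall>n. [int k * b n = 1] (mod ?p ^ n)"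
    using cong_solve_coprime_int[OF cop] by metis
  then obtain b where b: "\<And>n. [int k * b n = 1] (mod ?p ^ n)" by blast
  have coh: "[b (Suc n) = b n] (mod ?p ^ n)" for n
  proof -
    have "[int k * b (Suc n) = 1] (mod ?p ^ n)"
      by (rule cong_dvd_modulus[OF b[of "Suc n"]]) simp
    hence "[int k * b (Suc n) = int k * b n] (mod ?p ^ n)"
      using b[of n] by (metis cong_sym cong_trans)
    thus ?thesis using cong_mult_lcancel[OF cop] by blast
  qed
  define B :: "'p padic_int" where "B = Abs_padic_int (\<lambda>n. b n mod ?p ^ n)"
  have B: "Rep_padic_int B = (\<lambda>n. b n mod ?p ^ n)"
    unfolding B_def using coherent_modI[of b, OF coh] by (intro Abs_padic_int_inverse) simp
  have "of_nat k * B = 1"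
    by (subst Rep_padic_int_inject[symmetric])
      (use b in \<open>simp add: fun_eq_iff times_padic_int.rep_eq one_padic_int.rep_eq
        Rep_padic_int_of_nat B mod_simps cong_def\<close>)
  thus ?thesis by (metis dvdI)
qed

definition finite_polylog :: "int \<Rightarrow> ('p :: prime_card) padic_int poly" where
  "finite_polylog d = (\<Sum>k=1..CARD('p) - 1. monom (1 / of_nat k powi d) k)"

text \<open>
  Only used for \<open>k < p\<close>, where all the denominators are units.
\<close>

definition harmonic2 :: "nat \<Rightarrow> ('p :: prime_card) padic_int" where
  "harmonic2 k = (\<Sum>j=1..k. 1 / of_nat j ^ 2)"

end

theory Submission
  imports Defs
begin

text \<open>
  A polynomial over a field of characteristic \<open>p\<close> of degree at most \<open>p\<close> that has derivative \<open>0\<close>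
  and vanishes at \<open>0\<close> and \<open>1\<close> is \<open>0\<close>. All the congruences are proved over the field with \<open>p\<close>
  elements by this criterion. There \<open>p\<close> divides \<open>2k choose k\<close> for \<open>p/2 < k < p\<close>, so that
  \<open>\<Sum> (2k choose k) a\<^sub>k x\<^sup>k\<close> has degree less than \<open>p\<close> in \<open>\<beta>\<close>, while
  \<open>x d/d\<beta>\<close> acts on it as \<open>a\<^sub>k \<mapsto> k a\<^sub>k\<close> followed by multiplication by \<open>1 - 2\<beta>\<close>. This reduces the
  three identities to one another and to
  \<open>(1 - 2\<beta>) \<Sum> (2k choose k) x\<^sup>k = 1 - 2\<beta>\<^sup>p\<close> (summing from \<open>k = 0\<close>),
  \<open>\<pounds>\<^sub>1(\<alpha>) = \<pounds>\<^sub>1(\<beta>)\<close> and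
  \<open>(1 - 2\<beta>) \<Sum> (2k choose k) (\<Sum>\<^sub>j\<^sub>\<le>\<^sub>k 1/j\<^sup>2) x\<^sup>k = 2\<pounds>\<^sub>2(\<beta>) - 2\<pounds>\<^sub>2(\<alpha>)\<close>,
  which follow from the same criterion because \<open>1 - 2\<beta>\<close> is the square root of \<open>1 - 4x\<close>.
\<close>

section \<open>Vanishing criterion in characteristic p\<close>

lemma of_nat_neq_0_below_CHAR:
  assumes "k \<in> {1..CHAR('a :: semiring_1) - 1}"
  shows "(of_nat k :: 'a) \<noteq> 0"
proof -
  have "0 < k" "k < CHAR('a)" using assms by auto
  hence "\<not> CHAR('a) dvd k" by (simp add: nat_dvd_not_less)
  thus ?thesis by (simp add: of_nat_eq_0_iff_char_dvd)
qed

text \<open>Derivative 0 kills every coefficient of index 0 < n < p, because n is invertible. Within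
  degree p only the constant term and the term of index p survive, and the values at 0 and 1 detect
  these.\<close>

lemma poly_eq_0_of_pderiv_eq_0:
  fixes D :: "'a :: field poly"
  assumes "prime CHAR('a)" "pderiv D = 0" "degree D \<le> CHAR('a)" "poly D 0 = 0" "poly D 1 = 0"
  shows "D = 0"
proof -
  let ?p = "CHAR('a)"
  have small: "coeff D n = 0" if "n \<noteq> ?p" for n
  proof (cases "n = 0 \<or> n > ?p")
    case True
    thus ?thesis using assms by (auto simp: poly_0_coeff_0 intro: coeff_eq_0)
  next
    case False
    hence "0 < n" "n < ?p" using that by auto
    then obtain m where n: "n = Suc m" by (cases n) auto
    have "(of_nat n :: 'a) \<noteq> 0"
      using \<open>0 < n\<close> \<open>n < ?p\<close> by (intro of_nat_neq_0_below_CHAR) auto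
    moreover have "of_nat n * coeff D n = 0"
      using assms(2) coeff_pderiv[of D m] by (simp add: n)
    ultimately show ?thesis by simp
  qed
  have D: "D = monom (coeff D ?p) ?p"
    by (rule poly_eqI) (use small in auto)
  hence "poly D 1 = coeff D ?p" by (metis poly_monom power_one mult.right_neutral)
  with assms(5) D show ?thesis by simp
qed

section \<open>Sums with central binomial coefficients\<close>

lemma mult_pderiv_sum_powers:
  fixes a :: "nat \<Rightarrow> 'a :: field" and y :: "'a poly"
  shows "y * pderiv (\<Sum>k\<in>A. smult (a k) (y ^ k)) =
    pderiv y * (\<Sum>k\<in>A. smult (of_nat k * a k) (y ^ k))"
proof -
  have "y * pderiv (smult (a k) (y ^ k)) = pderiv y * smult (of_nat k * a k) (y ^ k)" for k
  proof (cases k)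
    case (Suc m)
    show ?thesis
      unfolding Suc pderiv_smult pderiv_power_Suc by (simp add: ac_simps del: of_nat_Suc)
  qed simp
  thus ?thesis by (simp add: pderiv_sum sum_distrib_left)
qed

text \<open>Coefficient form of (1 - 4x) f' = 2 f, the differential equation of f = (1 -
  4x)^(-1/2).\<close>

lemma Suc_times_central_binomial:
  "Suc k * ((2 * Suc k) choose Suc k) = (4 * k + 2) * ((2 * k) choose k)"
proof -
  have 1: "Suc k * ((2 * Suc k) choose Suc k) = (2 * Suc k) * (Suc (2 * k) choose k)"
    using Suc_times_binomial_eq[of "Suc (2 * k)" k] by (simp add: algebra_simps)
  have 2: "Suc k * (Suc (2 * k) choose k) = Suc (2 * k) * ((2 * k) choose k)"
    using Suc_times_binomial_eq[of "2 * k" k] binomial_symmetric[of k "Suc (2 * k)"]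
    by (simp add: algebra_simps)
  have "(2 * Suc k) * (Suc (2 * k) choose k) = 2 * (Suc k * (Suc (2 * k) choose k))"
    by (simp only: mult.assoc)
  also have "\<dots> = (4 * k + 2) * ((2 * k) choose k)"
    unfolding 2 by (simp add: algebra_simps)
  finally show ?thesis using 1 by simp
qed

text \<open>The prime divides (2k)! but not k!, so it is not cancelled.\<close>

lemma prime_dvd_central_binomial:
  assumes "prime p" "k < p" "p \<le> 2 * k"
  shows "p dvd ((2 * k) choose k)"
proof -
  have "fact k * fact (2 * k - k) * ((2 * k) choose k) = (fact (2 * k) :: nat)"
    by (rule binomial_fact_lemma) simp
  moreover have "p dvd fact (2 * k)" "\<not> p dvd fact k"
    using assms by (simp_all add: prime_dvd_fact_iff)
  ultimately show ?thesis
    using assms(1) by (metis prime_dvd_mult_iff diff_add_inverse mult_2)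
qed

text \<open>The polynomial \<open>[:0, 1, -1:]\<close> is x = \<beta>(1 - \<beta>). Index 0 is left
  out, so that \<open>a\<close> may involve 1/k; a constant term \<open>[:h 0:]\<close> is added
  where the full series is meant.\<close>

definition cb_sum :: "(nat \<Rightarrow> 'a) \<Rightarrow> 'a :: field poly" where
  "cb_sum a = (\<Sum>k=1..CHAR('a) - 1.
     smult (of_nat ((2 * k) choose k) * a k) ([:0, 1, -1:] ^ k))"

lemma cb_sum_add: "cb_sum (\<lambda>k. a k + b k) = cb_sum a + cb_sum b"
  by (simp add: cb_sum_def distrib_left smult_add_left sum.distrib)

text \<open>Every index of the sum is invertible in the field, so factors k may be cancelled inside
  it.\<close>

lemma cb_sum_cong:
  assumes "\<And>k. (of_nat k :: 'a :: field) \<noteq> 0 \<Longrightarrow> a k = b k"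
  shows "cb_sum a = (cb_sum b :: 'a poly)"
  unfolding cb_sum_def
  by (rule sum.cong[OF refl]) (use assms of_nat_neq_0_below_CHAR in metis)

lemma poly_cb_sum_0 [simp]: "poly (cb_sum a) 0 = 0"
  by (simp add: cb_sum_def poly_sum)

lemma poly_cb_sum_1 [simp]: "poly (cb_sum a) 1 = 0"
  by (simp add: cb_sum_def poly_sum)

lemma degree_cb_sum:
  assumes "prime CHAR('a :: field)"
  shows "degree (cb_sum a :: 'a poly) \<le> CHAR('a) - 1"
  unfolding cb_sum_def
proof (rule degree_sum_le)
  fix k assume k: "k \<in> {1..CHAR('a) - 1}"
  let ?t = "smult (of_nat ((2 * k) choose k) * a k) ([:0, 1, -1:] ^ k) :: 'a poly"
  show "degree ?t \<le> CHAR('a) - 1"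
  proof (cases "CHAR('a) \<le> 2 * k")
    case True
    have "CHAR('a) dvd ((2 * k) choose k)"
      using assms True k by (intro prime_dvd_central_binomial) auto
    hence "(of_nat ((2 * k) choose k) :: 'a) = 0"
      by (simp only: of_nat_eq_0_iff_char_dvd)
    thus ?thesis by simp
  next
    case False
    have "degree ?t \<le> 2 * k"
      using degree_smult_le order_trans degree_power_le[of "[:0, 1, -1 :: 'a:]" k]
      by (fastforce simp: mult.commute)
    with False show ?thesis by simp
  qed
qed simp

lemma mult_pderiv_cb_sum:
  "[:0, 1, -1:] * pderiv (cb_sum a) = [:1, -2:] * cb_sum (\<lambda>k. of_nat k * a k)"
proof -
  have "pderiv [:0, 1, -1 :: 'a:] = [:1, -2:]" by (simp add: pderiv_pCons)
  thus ?thesis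
    unfolding cb_sum_def by (subst mult_pderiv_sum_powers) (simp only: ac_simps)
qed

text \<open>
  The recurrence of the central binomial coefficients makes the left-hand side telescope. The top
  term of the truncated series drops out because it carries the factor \<open>p\<close>.
\<close>

lemma mult_pderiv_linear_times_cb_sum:
  fixes h :: "nat \<Rightarrow> 'a :: field"
  assumes "prime CHAR('a)"
  shows "[:0, 1, -1:] * pderiv ([:1, -2:] * ([:h 0:] + cb_sum h)) =
    cb_sum (\<lambda>k. of_nat k * (h k - h (k - 1)))"
proof -
  obtain q where q: "CHAR('a) = Suc q"
    using assms by (metis gr0_implies_Suc prime_gt_0_nat)
  define y l :: "'a poly" where "y = [:0, 1, -1:]" and "l = [:1, -2:]"
  have y': "pderiv y = l" by (simp add: y_def l_def pderiv_pCons)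
  have l': "pderiv l = -2" by (simp add: l_def pderiv_pCons numeral_poly)
  \<comment> \<open>The factor \<open>l\<close> from differentiating \<open>y\<close> meets the
    outer \<open>l\<close>; their product is a polynomial in \<open>y\<close>, so only powers of
    \<open>y\<close> remain.\<close>
  have ll: "l * l = 1 - 4 * y" by (simp add: y_def l_def numeral_poly one_pCons)
  define c :: "nat \<Rightarrow> 'a" where "c k = of_nat ((2 * k) choose k)" for k
  have c: "of_nat (Suc k) * c (Suc k) = (4 * of_nat k + 2) * c k" for k
    using arg_cong[OF Suc_times_central_binomial[of k], of "of_nat :: nat \<Rightarrow> 'a"]
    unfolding c_def by (simp only: of_nat_mult of_nat_add of_nat_numeral)
  define V where "V = (\<Sum>k\<le>q. smult (c k * h k) (y ^ k))"
  have shift: "(\<Sum>k\<le>q. smult (c k * a k) (y ^ k)) = [:a 0:] + cb_sum a" for a :: "nat \<Rightarrow> 'a"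
    by (simp add: cb_sum_def q y_def c_def atMost_atLeast0 sum.atLeast_Suc_atMost)
  have V: "V = [:h 0:] + cb_sum h"
    unfolding V_def by (rule shift)
  have yV: "y * pderiv V = l * (\<Sum>k\<le>q. smult (of_nat k * (c k * h k)) (y ^ k))"
    unfolding V_def by (simp add: mult_pderiv_sum_powers y')
  have "y * pderiv (l * V) = l * (y * pderiv V) - 2 * y * V"
    by (simp add: pderiv_mult l' algebra_simps)
  also have "\<dots> = (1 - 4 * y) * (\<Sum>k\<le>q. smult (of_nat k * (c k * h k)) (y ^ k)) - 2 * y * V"
    by (simp add: yV ll flip: mult.assoc)
  also have "\<dots> = (\<Sum>k\<le>q. smult (of_nat k * (c k * h k)) (y ^ k))
      - (\<Sum>k\<le>q. smult ((4 * of_nat k + 2) * c k * h k) (y ^ Suc k))"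
    unfolding V_def sum_distrib_left sum_subtractf[symmetric]
    by (rule sum.cong) (simp_all add: numeral_poly smult_add_left smult_diff_right algebra_simps)
  also have "(\<Sum>k\<le>q. smult ((4 * of_nat k + 2) * c k * h k) (y ^ Suc k)) =
      (\<Sum>k<Suc q. smult (of_nat (Suc k) * c (Suc k) * h k) (y ^ Suc k))"
    by (simp only: c lessThan_Suc_atMost)
  also have "\<dots> = (\<Sum>k<q. smult (of_nat (Suc k) * c (Suc k) * h k) (y ^ Suc k))"
  proof -
    have "(of_nat (Suc q) :: 'a) = 0" by (metis q of_nat_CHAR)
    thus ?thesis by (simp only: sum.lessThan_Suc) simp
  qed
  \<comment> \<open>The added term at k = 0 has the factor 0, so the truncated subtraction in
    \<open>h (k - 1)\<close> is harmless there.\<close>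
  also have "\<dots> = (\<Sum>k\<le>q. smult (of_nat k * c k * h (k - 1)) (y ^ k))"
    by (subst sum.atMost_shift) simp
  also have "(\<Sum>k\<le>q. smult (of_nat k * (c k * h k)) (y ^ k)) - \<dots> =
      (\<Sum>k\<le>q. smult (c k * (of_nat k * (h k - h (k - 1)))) (y ^ k))"
    by (simp add: algebra_simps smult_diff_left flip: sum_subtractf)
  also have "\<dots> = cb_sum (\<lambda>k. of_nat k * (h k - h (k - 1)))"
    by (subst shift) simp
  finally show ?thesis by (simp only: V y_def l_def)
qed

section \<open>Finite polylogarithms over a field of characteristic p\<close>

definition polylog_mod :: "nat \<Rightarrow> 'a :: field poly" where
  "polylog_mod d = (\<Sum>k=1..CHAR('a) - 1. monom (1 / of_nat k ^ d) k)"

lemma degree_polylog_mod: "degree (polylog_mod d :: 'a :: field poly) \<le> CHAR('a) - 1"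
  unfolding polylog_mod_def
  by (rule degree_sum_le) (auto intro: degree_monom_le order_trans)

lemma poly_polylog_mod_0 [simp]: "poly (polylog_mod d) 0 = 0"
  by (auto simp: polylog_mod_def poly_sum poly_monom intro!: sum.neutral)

lemma mult_pderiv_polylog_mod:
  "[:0, 1:] * pderiv (polylog_mod (Suc d)) = (polylog_mod d :: 'a :: field poly)"
proof -
  have "[:0, 1:] * pderiv (monom (1 / of_nat k ^ Suc d) k) = monom (1 / of_nat k ^ d :: 'a) k"
    if k: "k \<in> {1..CHAR('a) - 1}" for k
  proof -
    obtain m where m: "k = Suc m" using k by (cases k) auto
    have "[:0, 1:] * monom c m = monom c (Suc m)" for c :: 'a
      by (simp add: monom_Suc)
    thus ?thesis
      using of_nat_neq_0_below_CHAR[OF k] unfolding m pderiv_monom by (simp del: of_nat_Suc)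
  qed
  thus ?thesis
    unfolding polylog_mod_def by (simp add: pderiv_sum sum_distrib_left)
qed

text \<open>In weight 0 the polylogarithm is the geometric sum X + ... + X^(p-1). The chain of
  derivatives ends here.\<close>

lemma mult_polylog_mod_0:
  assumes "prime CHAR('a :: field)"
  shows "[:1, -1:] * polylog_mod 0 = [:0, 1:] - ([:0, 1:] ^ CHAR('a) :: 'a poly)"
proof -
  obtain q where q: "CHAR('a) = Suc q"
    using assms by (metis gr0_implies_Suc prime_gt_0_nat)
  let ?X = "[:0, 1:] :: 'a poly"
  have "polylog_mod 0 = (\<Sum>k=1..q. ?X ^ k)"
    by (simp add: polylog_mod_def q monom_altdef)
  also have "\<dots> = ?X * (\<Sum>k<q. ?X ^ k)"
    unfolding sum_distrib_left power_Suc[symmetric]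
    by (rule sum.reindex_bij_witness[of _ Suc "\<lambda>k. k - 1"]) auto
  finally have "[:1, -1:] * polylog_mod 0 = ?X * ((1 - ?X) * (\<Sum>k<q. ?X ^ k))"
    by (simp add: one_pCons)
  also have "(1 - ?X) * (\<Sum>k<q. ?X ^ k) = 1 - ?X ^ q"
    by (rule one_diff_power_eq[symmetric])
  finally show ?thesis by (simp only: q right_diff_distrib mult_1_right power_Suc)
qed

text \<open>The finite polylogarithm at \<alpha> = 1 - \<beta>, as a polynomial in \<beta>.\<close>

definition polylog_refl :: "nat \<Rightarrow> 'a :: field poly" where
  "polylog_refl d = pcompose (polylog_mod d) [:1, -1:]"

lemma degree_polylog_refl: "degree (polylog_refl d :: 'a :: field poly) \<le> CHAR('a) - 1"
  using degree_polylog_mod[where ?'a = 'a] by (simp add: polylog_refl_def degree_pcompose)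

lemma poly_polylog_refl [simp]: "poly (polylog_refl d) a = poly (polylog_mod d) (1 - a)"
  by (simp add: polylog_refl_def poly_pcompose)

lemma mult_pderiv_polylog_refl:
  "[:1, -1:] * pderiv (polylog_refl (Suc d)) = - (polylog_refl d :: 'a :: field poly)"
proof -
  let ?a = "[:1, -1:] :: 'a poly"
  have "pcompose [:0, 1:] ?a = ?a" by (simp add: pcompose_pCons)
  hence "?a * pcompose (pderiv (polylog_mod (Suc d))) ?a =
      pcompose ([:0, 1:] * pderiv (polylog_mod (Suc d))) ?a"
    by (simp only: pcompose_mult)
  also have "\<dots> = polylog_refl d"
    by (simp only: mult_pderiv_polylog_mod polylog_refl_def)
  finally have *: "?a * pcompose (pderiv (polylog_mod (Suc d))) ?a = polylog_refl d" .
  have "pderiv ?a = -1" by (simp add: pderiv_pCons one_pCons)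
  thus ?thesis
    unfolding polylog_refl_def[of "Suc d"] pderiv_pcompose by (simp only: flip: *) simp
qed

text \<open>The substitution X -> 1 - X in \<open>mult_polylog_mod_0\<close> swaps the two linear
  factors, and (1 - X)^p = 1 - X^p by Frobenius.\<close>

lemma mult_polylog_refl_0:
  assumes "prime CHAR('a :: field)"
  shows "[:0, 1:] * polylog_refl 0 = - ([:0, 1:] - ([:0, 1:] ^ CHAR('a) :: 'a poly))"
proof -
  let ?a = "[:1, -1:] :: 'a poly" and ?X = "[:0, 1:] :: 'a poly"
  have a: "pcompose ?X ?a = ?a" "pcompose ?a ?a = ?X" by (simp_all add: pcompose_pCons)
  have "?X * polylog_refl 0 = pcompose (?a * polylog_mod 0) ?a"
    by (simp only: pcompose_mult a polylog_refl_def)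
  also have "\<dots> = ?a - ?a ^ CHAR('a)"
    by (simp only: mult_polylog_mod_0[OF assms] pcompose_diff pcompose_hom.hom_power a)
  also have "?a ^ CHAR('a) = 1 - ?X ^ CHAR('a)"
  proof -
    have "?X + ?a = 1" by (simp add: one_pCons)
    moreover have "(?X + ?a) ^ CHAR('a) = ?X ^ CHAR('a) + ?a ^ CHAR('a)"
      by (rule freshmans_dream) (use assms in simp_all)
    ultimately show ?thesis by (metis power_one add_diff_cancel_left')
  qed
  also have "?a = 1 - ?X" by (simp add: one_pCons)
  finally show ?thesis by simp
qed

text \<open>The value at 1 is the sum S of u^(-d) over the nonzero field elements u. Multiplication
  by a permutes these, so S = a^d S.\<close>

lemma poly_polylog_mod_1:
  fixes a :: "'p :: prime_card mod_ring"
  assumes "a \<noteq> 0" "a ^ d \<noteq> 1"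
  shows "poly (polylog_mod d :: 'p mod_ring poly) 1 = 0"
proof -
  let ?N = "{1..CARD('p) - 1}" and ?U = "UNIV - {0 :: 'p mod_ring}"
  have inj: "inj_on (of_nat :: nat \<Rightarrow> 'p mod_ring) ?N"
    by (rule inj_onI) (auto simp: of_nat_eq_iff_cong_CHAR cong_def)
  have img: "of_nat ` ?N = ?U"
  proof (rule card_subset_eq)
    show "of_nat ` ?N \<subseteq> ?U"
      using of_nat_neq_0_below_CHAR[where ?'a = "'p mod_ring"] by auto
    show "card (of_nat ` ?N :: 'p mod_ring set) = card ?U"
      unfolding card_image[OF inj] by (simp add: card_Diff_singleton)
  qed simp
  have "poly (polylog_mod d :: 'p mod_ring poly) 1 = (\<Sum>k\<in>?N. 1 / of_nat k ^ d)"
    by (simp add: polylog_mod_def poly_sum poly_monom)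
  also have "\<dots> = (\<Sum>u\<in>?U. 1 / u ^ d)"
    unfolding img[symmetric] sum.reindex[OF inj] o_def ..
  finally have S: "poly (polylog_mod d :: 'p mod_ring poly) 1 = (\<Sum>u\<in>?U. 1 / u ^ d)" .
  have "(\<Sum>u\<in>?U. 1 / u ^ d) = (\<Sum>u\<in>?U. 1 / (u / a) ^ d)"
    by (rule sum.reindex_bij_witness[of _ "\<lambda>u. u / a" "\<lambda>u. u * a"]) (use assms in auto)
  also have "\<dots> = a ^ d * (\<Sum>u\<in>?U. 1 / u ^ d)"
    by (simp add: sum_distrib_left power_divide)
  finally have "(a ^ d - 1) * (\<Sum>u\<in>?U. 1 / u ^ d) = 0"
    by (simp add: algebra_simps)
  with assms S show ?thesis by simp
qed

text \<open>The multiplier is -1 for odd d and 2 for d = 2; the latter works because 2^2 - 1 = 3 is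
  nonzero for p > 3.\<close>

lemma poly_polylog_mod_1_small:
  assumes "CARD('p :: prime_card) > 3" "d \<in> {1, 2, 3}"
  shows "poly (polylog_mod d :: 'p mod_ring poly) 1 = 0"
proof -
  have "(of_nat k :: 'p mod_ring) \<noteq> 0" if "k \<in> {1, 2, 3}" for k
    using assms(1) that by (intro of_nat_neq_0_below_CHAR) auto
  from this[of 2] this[of 3] have nz: "(2 :: 'p mod_ring) \<noteq> 0" "(3 :: 'p mod_ring) \<noteq> 0"
    by simp_all
  have *: "(2 :: 'p mod_ring) ^ 2 \<noteq> 1"
  proof
    assume "(2 :: 'p mod_ring) ^ 2 = 1"
    moreover have "(3 :: 'p mod_ring) = 2 ^ 2 - 1" by simp
    ultimately have "(3 :: 'p mod_ring) = 0" by simp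
    with nz show False by simp
  qed
  have "(-1 :: 'p mod_ring) \<noteq> 1"
  proof
    assume "(-1 :: 'p mod_ring) = 1"
    hence "(1 :: 'p mod_ring) + 1 = 0" by (metis add.right_inverse)
    with nz show False by simp
  qed
  with assms(2) poly_polylog_mod_1[of "-1 :: 'p mod_ring" d]
    poly_polylog_mod_1[OF nz(1) *] show ?thesis by auto
qed

section \<open>The three identities over the field with p elements\<close>

context
  assumes p_gt_3: "CARD('p :: prime_card) > 3"
begin

private definition X :: "'p mod_ring poly" where "X = [:0, 1:]"
private abbreviation L :: "nat \<Rightarrow> 'p mod_ring poly" where "L \<equiv> polylog_mod"
private abbreviation R :: "nat \<Rightarrow> 'p mod_ring poly" where "R \<equiv> polylog_refl"

lemma X_eq: "[:0, 1, -1:] = X * (1 - X)" "[:1, -2:] = 1 - 2 * X" "[:1, -1:] = 1 - X" "[:0, 1:] = X"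
  by (simp_all add: X_def one_pCons numeral_poly)

lemma prime_CHAR_p: "prime CHAR('p mod_ring)"
  by (simp add: prime_card)

text \<open>The derivative formulas carry the factor X(1 - X), which clears the denominators \<beta>
  and 1 - \<beta>. It is nonzero, hence cancels, and the criterion applies to
  \<open>P - Q\<close>.\<close>

lemma eqI_mod:
  fixes P Q :: "'p mod_ring poly"
  assumes "X * (1 - X) * pderiv P = X * (1 - X) * pderiv Q"
    and "degree P \<le> CARD('p)" "degree Q \<le> CARD('p)"
    and "poly P 0 = poly Q 0" "poly P 1 = poly Q 1"
  shows "P = Q"
proof -
  have "X * (1 - X) \<noteq> 0" by (simp flip: X_eq(1))
  hence "pderiv P = pderiv Q"
    using assms(1) mult_left_cancel[of "X * (1 - X)" "pderiv P" "pderiv Q"] by blast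
  hence "pderiv (P - Q) = 0" by (simp add: pderiv_diff)
  with prime_CHAR_p have "P - Q = 0"
    by (rule poly_eq_0_of_pderiv_eq_0) (use assms(2-) in \<open>simp_all add: degree_diff_le\<close>)
  thus ?thesis by simp
qed

lemma degree_numeral_mult:
  "degree (numeral n * P) \<le> d" if "degree P \<le> d" for P :: "'p mod_ring poly"
  using that degree_mult_le[of "numeral n" P] by simp

text \<open>In the last bound the factor 1 - 2X raises p - 1 to p, the largest degree that the
  criterion admits.\<close>

lemma degree_bounds:
  "degree (L d) \<le> CARD('p)" "degree (R d) \<le> CARD('p)"
  "degree (cb_sum a :: 'p mod_ring poly) \<le> CARD('p)"
  "degree ((1 - 2 * X) * ([:h:] + cb_sum a) :: 'p mod_ring poly) \<le> CARD('p)"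
proof -
  have p: "CARD('p) = Suc (CARD('p) - 1)" using p_gt_3 by simp
  show "degree (L d) \<le> CARD('p)" "degree (R d) \<le> CARD('p)"
    using degree_polylog_mod[of d, where ?'a = "'p mod_ring"]
      degree_polylog_refl[of d, where ?'a = "'p mod_ring"] by simp_all
  have V: "degree (cb_sum a :: 'p mod_ring poly) \<le> CARD('p) - 1"
    using degree_cb_sum[OF prime_CHAR_p] by simp
  thus "degree (cb_sum a :: 'p mod_ring poly) \<le> CARD('p)" by simp
  from V have "degree ([:h:] + cb_sum a :: 'p mod_ring poly) \<le> CARD('p) - 1"
    by (intro degree_add_le) simp_all
  moreover have "degree [:1, -2 :: 'p mod_ring:] \<le> 1" by simp
  ultimately have "degree ([:1, -2:] * ([:h:] + cb_sum a) :: 'p mod_ring poly) \<le> CARD('p)"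
    using degree_mult_le[of "[:1, -2 :: 'p mod_ring:]" "[:h:] + cb_sum a"] p by linarith
  thus "degree ((1 - 2 * X) * ([:h:] + cb_sum a) :: 'p mod_ring poly) \<le> CARD('p)"
    by (simp only: X_eq)
qed

lemma poly_X [simp]: "poly X a = a"
  by (simp add: X_def)

text \<open>Reflection swaps 0 and 1, so with the value 0 at 0 this yields both endpoint values of
  \<open>L d\<close> and of \<open>R d\<close>.\<close>

lemma values_at_1: "d \<in> {1, 2, 3} \<Longrightarrow> poly (L d) 1 = 0"
  using p_gt_3 by (rule poly_polylog_mod_1_small)

text \<open>The premise \<open>d = Suc e\<close> allows numeral weights such as 2 and 3.\<close>

lemma mult_pderiv_L: "d = Suc e \<Longrightarrow> X * (1 - X) * pderiv (L d) = (1 - X) * L e"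
  using mult_pderiv_polylog_mod[of e, where ?'a = "'p mod_ring"]
  by (simp only: X_eq mult.assoc mult.left_commute[of X])

lemma mult_pderiv_R: "d = Suc e \<Longrightarrow> X * (1 - X) * pderiv (R d) = - (X * R e)"
  using mult_pderiv_polylog_refl[of e, where ?'a = "'p mod_ring"]
  by (simp only: X_eq mult.assoc mult_minus_right)

lemma mult_pderiv_cb_sum_X:
  "X * (1 - X) * pderiv (cb_sum a) = (1 - 2 * X) * cb_sum (\<lambda>k. of_nat k * a k)"
  by (rule mult_pderiv_cb_sum[of a, unfolded X_eq(1,2)])

lemma mult_pderiv_1:
  "X * (1 - X) * pderiv (L 1) = X - X ^ CARD('p)"
  "X * (1 - X) * pderiv (R 1) = X - X ^ CARD('p)"
  using mult_pderiv_L[of 1 0] mult_pderiv_R[of 1 0] mult_polylog_mod_0[OF prime_CHAR_p]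
    mult_polylog_refl_0[OF prime_CHAR_p]
  by (simp_all only: X_eq One_nat_def semiring_char_mod_ring minus_minus)

lemma pderiv_numeral_mult: "pderiv (numeral n * P) = numeral n * pderiv (P :: 'p mod_ring poly)"
  by (simp add: numeral_poly pderiv_smult)

lemma polylog_refl_1: "R 1 = L 1"
proof (rule eqI_mod)
  show "X * (1 - X) * pderiv (R 1) = X * (1 - X) * pderiv (L 1)"
    by (simp only: mult_pderiv_1)
qed (use values_at_1[of 1] in \<open>simp_all add: degree_bounds\<close>)

text \<open>For constant h the differences h k - h (k - 1) vanish, and so does the derivative. The
  right-hand side is (1 - 2X)^p, so the truncated series equals (1 - 4x)^((p-1)/2).\<close>

lemma linear_times_cb_sum_1: "(1 - 2 * X) * (1 + cb_sum (\<lambda>_. 1)) = 1 - 2 * X ^ CARD('p)"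
proof (rule eqI_mod)
  have "cb_sum (\<lambda>k. 0) = (0 :: 'p mod_ring poly)" by (simp add: cb_sum_def)
  hence "X * (1 - X) * pderiv ((1 - 2 * X) * (1 + cb_sum (\<lambda>_. 1))) = 0"
    using mult_pderiv_linear_times_cb_sum[OF prime_CHAR_p, of "\<lambda>_. 1"]
    by (simp only: X_eq(1,2) pCons_one diff_self mult_zero_right)
  moreover have "pderiv (X ^ CARD('p)) = 0"
    by (simp add: pderiv_power)
  hence "pderiv (1 - 2 * X ^ CARD('p)) = 0"
    by (simp only: pderiv_diff pderiv_numeral_mult pderiv_1 mult_zero_right diff_self)
  ultimately show "X * (1 - X) * pderiv ((1 - 2 * X) * (1 + cb_sum (\<lambda>_. 1))) =
      X * (1 - X) * pderiv (1 - 2 * X ^ CARD('p))" by simp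
  show "degree ((1 - 2 * X) * (1 + cb_sum (\<lambda>_. 1))) \<le> CARD('p)"
    using degree_bounds(4)[of 1] by (simp only: pCons_one)
  show "degree (1 - 2 * X ^ CARD('p)) \<le> CARD('p)"
    by (intro degree_diff_le degree_numeral_mult) (simp_all add: degree_power_eq X_def)
qed (use p_gt_3 in simp_all)

lemma cb_sum_polylog_1: "cb_sum (\<lambda>k. 1 / of_nat k) = R 1 + L 1"
proof (rule eqI_mod)
  let ?F = "cb_sum (\<lambda>_. 1) :: 'p mod_ring poly"
  have "X * (1 - X) * pderiv (cb_sum (\<lambda>k. 1 / of_nat k)) =
      (1 - 2 * X) * cb_sum (\<lambda>k. of_nat k * (1 / of_nat k))"
    by (rule mult_pderiv_cb_sum_X)
  also have "cb_sum (\<lambda>k. of_nat k * (1 / of_nat k)) = ?F"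
    by (rule cb_sum_cong) simp
  \<comment> \<open>Removing the term of index 0 subtracts 1 - 2X from 1 - 2X^p.\<close>
  also have "(1 - 2 * X) * ?F = 2 * (X - X ^ CARD('p))"
    using linear_times_cb_sum_1 by (simp add: algebra_simps)
  also have "\<dots> = X * (1 - X) * pderiv (R 1 + L 1)"
    unfolding pderiv_add distrib_left mult_pderiv_1 by Groebner_Basis.algebra
  finally show "X * (1 - X) * pderiv (cb_sum (\<lambda>k. 1 / of_nat k)) =
      X * (1 - X) * pderiv (R 1 + L 1)" .
qed (use values_at_1[of 1] in \<open>simp_all add: degree_bounds degree_add_le\<close>)

lemma cb_sum_polylog_2: "cb_sum (\<lambda>k. 1 / of_nat k ^ 2) = 2 * R 2 + 2 * L 2"
proof (rule eqI_mod)
  have "X * (1 - X) * pderiv (cb_sum (\<lambda>k. 1 / of_nat k ^ 2)) =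
      (1 - 2 * X) * cb_sum (\<lambda>k. of_nat k * (1 / of_nat k ^ 2))"
    by (rule mult_pderiv_cb_sum_X)
  also have "cb_sum (\<lambda>k. of_nat k * (1 / of_nat k ^ 2)) = R 1 + L 1"
    unfolding cb_sum_polylog_1[symmetric] by (rule cb_sum_cong) (simp add: power2_eq_square)
  \<comment> \<open>As \<open>R 1 = L 1\<close>, both sides are 2(1 - 2X) times
    \<open>L 1\<close>.\<close>
  also have "(1 - 2 * X) * (R 1 + L 1) = X * (1 - X) * pderiv (2 * R 2 + 2 * L 2)"
    unfolding pderiv_add pderiv_numeral_mult
    using mult_pderiv_R[OF Suc_1[symmetric]] mult_pderiv_L[OF Suc_1[symmetric]] polylog_refl_1
    by Groebner_Basis.algebra
  finally show "X * (1 - X) * pderiv (cb_sum (\<lambda>k. 1 / of_nat k ^ 2)) =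
      X * (1 - X) * pderiv (2 * R 2 + 2 * L 2)" .
qed (use values_at_1[of 2] in
  \<open>simp_all add: degree_bounds degree_add_le degree_numeral_mult\<close>)

text \<open>Here h 0 = 0 and k(h k - h (k - 1)) = 1/k, which leads back to the first identity. The
  result supplies the harmonic part of the third.\<close>

lemma linear_times_cb_sum_harmonic:
  "(1 - 2 * X) * cb_sum (\<lambda>k. \<Sum>j=1..k. 1 / of_nat j ^ 2) = 2 * L 2 - 2 * R 2"
proof (rule eqI_mod)
  let ?h = "\<lambda>k. \<Sum>j=1..k. 1 / of_nat j ^ 2 :: 'p mod_ring"
  have h: "of_nat k * (?h k - ?h (k - 1)) = 1 / of_nat k" if "(of_nat k :: 'p mod_ring) \<noteq> 0" for k
    using that by (cases k) (auto simp: power2_eq_square simp del: of_nat_Suc)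
  have "X * (1 - X) * pderiv ((1 - 2 * X) * cb_sum ?h) =
      cb_sum (\<lambda>k. of_nat k * (?h k - ?h (k - 1)))"
    using mult_pderiv_linear_times_cb_sum[OF prime_CHAR_p, of ?h]
    unfolding X_eq(1,2) by simp
  also have "\<dots> = R 1 + L 1"
    unfolding cb_sum_polylog_1[symmetric] by (rule cb_sum_cong) (rule h)
  \<comment> \<open>The derivative is 2(1 - X) \<open>L 1\<close> + 2X \<open>R 1\<close>, which
    collapses to 2 \<open>L 1\<close> because \<open>R 1 = L 1\<close>.\<close>
  also have "\<dots> = X * (1 - X) * pderiv (2 * L 2 - 2 * R 2)"
    unfolding pderiv_diff pderiv_numeral_mult
    using mult_pderiv_R[OF Suc_1[symmetric]] mult_pderiv_L[OF Suc_1[symmetric]] polylog_refl_1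
    by Groebner_Basis.algebra
  finally show "X * (1 - X) * pderiv ((1 - 2 * X) * cb_sum ?h) =
      X * (1 - X) * pderiv (2 * L 2 - 2 * R 2)" .
  show "degree ((1 - 2 * X) * cb_sum ?h) \<le> CARD('p)"
    using degree_bounds(4)[of 0 ?h] by simp
qed (use values_at_1[of 2] in
  \<open>simp_all add: degree_bounds degree_diff_le degree_numeral_mult\<close>)

lemma cb_sum_polylog_3:
  "cb_sum (\<lambda>k. (\<Sum>j=1..k. 1 / of_nat j ^ 2) / of_nat k + 1 / of_nat k ^ 3) = 4 * R 3 + 4 * L 3"
proof (rule eqI_mod)
  let ?h = "\<lambda>k. \<Sum>j=1..k. 1 / of_nat j ^ 2 :: 'p mod_ring"
  let ?a = "\<lambda>k. ?h k / of_nat k + 1 / of_nat k ^ 3"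
  have 3: "(3 :: nat) = Suc 2" by simp
  have "X * (1 - X) * pderiv (cb_sum ?a) = (1 - 2 * X) * cb_sum (\<lambda>k. of_nat k * ?a k)"
    by (rule mult_pderiv_cb_sum_X)
  also have "cb_sum (\<lambda>k. of_nat k * ?a k) = cb_sum (\<lambda>k. ?h k + 1 / of_nat k ^ 2)"
    by (rule cb_sum_cong) (simp add: distrib_left power3_eq_cube power2_eq_square)
  also have "\<dots> = cb_sum ?h + (2 * R 2 + 2 * L 2)"
    by (simp only: cb_sum_add cb_sum_polylog_2)
  \<comment> \<open>The harmonic part 2 \<open>L 2\<close> - 2 \<open>R 2\<close> completes the
    factors 2(1 - 2X) to 4(1 - X) and -4X, the pattern of the derivatives in weight 3.\<close>
  also have "(1 - 2 * X) * \<dots> = 4 * ((1 - X) * L 2) - 4 * (X * R 2)"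
    using linear_times_cb_sum_harmonic by Groebner_Basis.algebra
  also have "\<dots> = X * (1 - X) * pderiv (4 * R 3 + 4 * L 3)"
    unfolding pderiv_add pderiv_numeral_mult
    using mult_pderiv_R[OF 3] mult_pderiv_L[OF 3] by Groebner_Basis.algebra
  finally show "X * (1 - X) * pderiv (cb_sum ?a) = X * (1 - X) * pderiv (4 * R 3 + 4 * L 3)" .
qed (use values_at_1[of 3] in
  \<open>simp_all add: degree_bounds degree_add_le degree_numeral_mult\<close>)

end

section \<open>Reduction from the p-adic integers modulo p\<close>

definition reduce :: "'p :: prime_card padic_int \<Rightarrow> 'p mod_ring" where
  "reduce a = of_int (Rep_padic_int a 1)"

lemma of_int_mod_CARD:
  "(of_int (k mod int CARD('p)) :: 'p :: prime_card mod_ring) = of_int k"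
  using of_int_mod_CHAR[of k, where ?'a = "'p mod_ring"] by simp

interpretation reduce: comm_ring_hom reduce
  by standard (simp_all add: reduce_def zero_padic_int.rep_eq one_padic_int.rep_eq
    plus_padic_int.rep_eq times_padic_int.rep_eq of_int_mod_CARD)

interpretation reduce_poly: map_poly_comm_ring_hom reduce ..

lemma reduce_divide:
  fixes a :: "'p :: prime_card padic_int"
  assumes "a dvd 1"
  shows "reduce (b / a) = reduce b / reduce a"
proof -
  have "reduce a * reduce (inverse a) = 1"
    using padic_unit_inverse[OF assms] by (metis reduce.hom_mult reduce.hom_one)
  hence "reduce (inverse a) = inverse (reduce a)"
    by (metis inverse_unique)
  thus ?thesis by (simp add: divide_padic_int_def reduce.hom_mult divide_inverse)
qed

text \<open>Division by p shifts the sequence: the quotient modulo p^n is determined by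
  \<open>a\<close> modulo p^(n+1), so its entry n comes from \<open>r (Suc n) div p\<close>.\<close>

lemma reduce_eq_0_imp_dvd:
  fixes a :: "'p :: prime_card padic_int"
  assumes "reduce a = 0"
  shows "of_nat CARD('p) dvd a"
proof -
  let ?p = "int CARD('p)"
  define r where "r = Rep_padic_int a"
  have r: "r n \<in> {0..<?p ^ n}" "r (Suc n) mod ?p ^ n = r n" for n
    using Rep_padic_int[of a] by (auto simp: r_def)
  have "(of_int (r 1) :: 'p mod_ring) = 0" using assms by (simp add: reduce_def r_def)
  hence "?p dvd r 1" by (simp add: of_int_eq_0_iff_char_dvd)
  \<comment> \<open>Entry 1 is the representative in {0..<p}, so divisibility by p forces it to be
    0.\<close>
  hence r1: "r 1 = 0" using r(1)[of 1] by (auto dest: zdvd_imp_le)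
  have dvd: "?p dvd r (Suc n)" for n
  proof (induction n)
    case (Suc n)
    have "?p dvd r (Suc (Suc n)) mod ?p ^ Suc n" using Suc r(2)[of "Suc n"] by simp
    thus ?case by (simp add: dvd_mod_iff)
  qed (use r1 in simp)
  define b where "b n = r (Suc n) div ?p" for n
  have b: "r (Suc n) = ?p * b n" for n using dvd[of n] by (simp add: b_def)
  have coh: "[b (Suc n) = b n] (mod ?p ^ n)" for n
  proof -
    have "[r (Suc (Suc n)) = r (Suc n)] (mod ?p ^ Suc n)"
      using r(2)[of "Suc n"] by (metis cong_def mod_mod_trivial)
    hence "?p * ?p ^ n dvd ?p * (b (Suc n) - b n)"
      by (simp add: b cong_iff_dvd_diff right_diff_distrib)
    thus ?thesis by (simp add: cong_iff_dvd_diff)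
  qed
  define B :: "'p padic_int" where "B = Abs_padic_int (\<lambda>n. b n mod ?p ^ n)"
  have B: "Rep_padic_int B = (\<lambda>n. b n mod ?p ^ n)"
    unfolding B_def using coherent_modI[of b, OF coh] by (intro Abs_padic_int_inverse) simp
  have "?p * b n mod ?p ^ n = r n" for n
    using r(2)[of n] by (simp add: b)
  hence "a = of_nat CARD('p) * B"
    by (subst Rep_padic_int_inject[symmetric])
      (simp add: fun_eq_iff times_padic_int.rep_eq Rep_padic_int_of_nat B mod_simps flip: r_def)
  thus ?thesis by simp
qed

lemma map_poly_reduce_eq_imp_dvd:
  fixes P Q :: "'p :: prime_card padic_int poly"
  assumes "map_poly reduce P = map_poly reduce Q"
  shows "of_nat CARD('p) dvd P - Q"
proof -
  have "of_nat CARD('p) dvd coeff (P - Q) n" for n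
  proof (rule reduce_eq_0_imp_dvd)
    have "coeff (map_poly reduce P) n = coeff (map_poly reduce Q) n" by (simp only: assms)
    thus "reduce (coeff (P - Q) n) = 0" by (simp add: reduce.hom_minus)
  qed
  then obtain c where c: "\<And>n. coeff (P - Q) n = of_nat CARD('p) * c n"
    unfolding dvd_def by metis
  \<comment> \<open>The chosen quotients \<open>c n\<close> form only a function; cutting it off at
    the degree gives a polynomial.\<close>
  define C where "C = (\<Sum>n\<le>degree (P - Q). monom (c n) n)"
  have "P - Q = (\<Sum>n\<le>degree (P - Q). monom (coeff (P - Q) n) n)"
    by (rule poly_as_sum_of_monoms[symmetric])
  also have "\<dots> = of_nat CARD('p) * C"
    unfolding c C_def by (simp add: of_nat_poly smult_monom smult_sum2)
  finally show ?thesis by simp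
qed

lemma of_nat_dvd_1_below_CARD:
  assumes "k \<in> {1..CARD('p :: prime_card) - 1}"
  shows "(of_nat k :: 'p padic_int) dvd 1"
proof (rule padic_of_nat_unit)
  have "0 < k" "k < CARD('p)" using assms by auto
  thus "\<not> CARD('p) dvd k" by (simp add: nat_dvd_not_less)
qed

lemma reduce_divide_of_nat:
  fixes b :: "'p :: prime_card padic_int"
  assumes "k \<in> {1..CARD('p) - 1}"
  shows "reduce (b / of_nat k ^ n) = reduce b / of_nat k ^ n"
    and "reduce (b / of_nat k) = reduce b / of_nat k"
proof -
  have k: "(of_nat k :: 'p padic_int) dvd 1" using assms by (rule of_nat_dvd_1_below_CARD)
  moreover have "(of_nat k ^ n :: 'p padic_int) dvd 1"
    using dvd_power_same[OF k, of n] by simp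
  ultimately show "reduce (b / of_nat k ^ n) = reduce b / of_nat k ^ n"
    "reduce (b / of_nat k) = reduce b / of_nat k"
    by (simp_all add: reduce_divide reduce.hom_power reduce.hom_of_nat)
qed

lemma map_poly_reduce_finite_polylog:
  "map_poly reduce (finite_polylog (int d) :: 'p :: prime_card padic_int poly) = polylog_mod d"
  unfolding finite_polylog_def polylog_mod_def reduce_poly.hom_sum
  by (auto simp: reduce_divide_of_nat intro!: sum.cong)

lemma reduce_harmonic2:
  assumes "k \<in> {1..CARD('p :: prime_card) - 1}"
  shows "reduce (harmonic2 k :: 'p padic_int) = (\<Sum>j=1..k. 1 / of_nat j ^ 2)"
  unfolding harmonic2_def reduce.hom_sum
  by (rule sum.cong) (use assms in \<open>auto simp: reduce_divide_of_nat\<close>)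

text \<open>Common form of the three left-hand sides. Only indices below p occur, where the
  denominators are units and reduction commutes with division.\<close>

lemma map_poly_reduce_sum:
  fixes a :: "nat \<Rightarrow> 'p :: prime_card padic_int"
  assumes "\<And>k. k \<in> {1..CARD('p) - 1} \<Longrightarrow> reduce (a k) = of_nat ((2 * k) choose k) * b k"
  shows "map_poly reduce (\<Sum>k=1..CARD('p) - 1. smult (a k) ([:0, 1, -1:] ^ k)) = cb_sum b"
proof -
  have y: "map_poly reduce [:0, 1, -1:] = [:0, 1, -1:]"
    by (simp add: reduce.hom_uminus)
  show ?thesis
    unfolding cb_sum_def reduce_poly.hom_sum
    by (rule sum.cong) (simp_all add: assms y reduce.map_poly_hom_smult reduce_poly.hom_power)
qed

theorem theorem7p1:
  fixes p :: nat
    and \<alpha> \<beta> x :: "('p :: prime_card) padic_int poly"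
  assumes "p = CARD('p)" and "p > 3"
    and "\<beta> = [:0, 1:]" and "x = \<beta> * (1 - \<beta>)" and "\<alpha> = 1 - \<beta>"
  shows "of_nat p dvd
      (\<Sum>k=1..p - 1. smult (of_nat ((2 * k) choose k) / of_nat k) (x ^ k))
      - (pcompose (finite_polylog 1) \<alpha> + pcompose (finite_polylog 1) \<beta>)
    \<and> of_nat p dvd
      (\<Sum>k=1..p - 1. smult (of_nat ((2 * k) choose k) / of_nat k ^ 2) (x ^ k))
      - (2 * pcompose (finite_polylog 2) \<alpha> + 2 * pcompose (finite_polylog 2) \<beta>)
    \<and> of_nat p dvd
      (\<Sum>k=1..p - 1.
        smult (of_nat ((2 * k) choose k) * (harmonic2 k / of_nat k + 1 / of_nat k ^ 3)) (x ^ k))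
      - (4 * pcompose (finite_polylog 3) \<alpha> + 4 * pcompose (finite_polylog 3) \<beta>)"
proof -
  have A: "\<alpha> = [:1, -1:]" and x: "x = [:0, 1, -1:]"
    by (simp_all add: assms one_pCons)
  have p: "CARD('p) > 3" using assms by simp
  have A': "map_poly reduce [:1, -1 :: 'p padic_int:] = [:1, -1:]"
    by (simp add: reduce.hom_uminus)
  \<comment> \<open>The casts of the natural weights 1, 2, 3 become the integer literals taken by
    \<open>finite_polylog\<close>.\<close>
  note polylog = map_poly_reduce_finite_polylog[of 1, where ?'p = 'p, unfolded of_nat_1 of_nat_numeral]
    map_poly_reduce_finite_polylog[of 2, where ?'p = 'p, unfolded of_nat_1 of_nat_numeral]
    map_poly_reduce_finite_polylog[of 3, where ?'p = 'p, unfolded of_nat_1 of_nat_numeral]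
  have refl: "map_poly reduce (pcompose P \<alpha>) = pcompose (map_poly reduce P) [:1, -1:]" for P
    by (simp only: A reduce.map_poly_pcompose A')
  have id: "pcompose P \<beta> = P" for P
    by (simp add: assms)
  note hom = reduce_poly.hom_add reduce_poly.hom_mult reduce_poly.hom_numeral refl id polylog
    polylog_refl_def[symmetric]
  show ?thesis
    unfolding x assms(1)
  \<comment> \<open>Each congruence follows from equality of the reductions, which is an identity
    over the field.\<close>
  proof (intro conjI map_poly_reduce_eq_imp_dvd)
    show "map_poly reduce (\<Sum>k=1..CARD('p) - 1.
          smult (of_nat ((2 * k) choose k) / of_nat k) ([:0, 1, -1:] ^ k)) =
        map_poly reduce (pcompose (finite_polylog 1) \<alpha> + pcompose (finite_polylog 1) \<beta>)"
      unfolding hom cb_sum_polylog_1[OF p, symmetric]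
      by (rule map_poly_reduce_sum) (simp add: reduce_divide_of_nat reduce.hom_of_nat)
    show "map_poly reduce (\<Sum>k=1..CARD('p) - 1.
          smult (of_nat ((2 * k) choose k) / of_nat k ^ 2) ([:0, 1, -1:] ^ k)) =
        map_poly reduce (2 * pcompose (finite_polylog 2) \<alpha> + 2 * pcompose (finite_polylog 2) \<beta>)"
      unfolding hom cb_sum_polylog_2[OF p, symmetric]
      by (rule map_poly_reduce_sum) (simp add: reduce_divide_of_nat reduce.hom_of_nat)
    show "map_poly reduce (\<Sum>k=1..CARD('p) - 1.
          smult (of_nat ((2 * k) choose k) * (harmonic2 k / of_nat k + 1 / of_nat k ^ 3))
            ([:0, 1, -1:] ^ k)) =
        map_poly reduce (4 * pcompose (finite_polylog 3) \<alpha> + 4 * pcompose (finite_polylog 3) \<beta>)"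
      unfolding hom cb_sum_polylog_3[OF p, symmetric]
      by (rule map_poly_reduce_sum)
        (simp add: reduce_divide_of_nat reduce.hom_of_nat reduce.hom_mult reduce.hom_add
          reduce_harmonic2)
  qed
qed

end
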